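(* Let $\{y_t\}_{t\in\mathbb{Z}}$ satisfy the TV-ARMA($p,q$) equation $y_t=\varphi(t)+\sum_{m=1}^{p}\phi_m(t)y_{t-m}+u_t$, $u_t=\varepsilon_t+\sum_{l=1}^{q}\theta_l(t)\varepsilon_{t-l}$, $t\in\mathbb{Z}$. For $s<t$ and $k=t-s$, the explicit representation $$y_t=\sum_{m=1}^{p}\xi^{(m)}(t,s)y_{s+1-m}+\sum_{r=s+1}^{t}\xi(t,r)\varphi(r)+\sum_{r=s+1}^{t}\xi_q(t,r)\varepsilon_r+\sum_{r=s+1-q}^{s}\xi_{s,q}(t,r)\varepsilon_r$$ can be equivalently expressed in terms of polynomial operators as $$\Xi_{t,p}^{[k]}(B)y_t=\Xi_t^{(k)}(B)\circ[\varphi(t)+u_t]=\Xi_t^{(k)}(B)\circ\varphi(t)+\Xi_{t,q}^{(k)}(B)\varepsilon_t .$$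
   Context: Let $p,q\ge1$ be integers. The coefficients $\varphi(t),\phi_m(t),\theta_l(t)$ are deterministic functions of $t$ or random variables. The errors satisfy $\mathbb{E}(\varepsilon_t)=0$, $\mathbb{E}(\varepsilon_t\varepsilon_s)=0$ for $s\ne t$, $\mathbb{E}(\varepsilon_t\mid y_s,s<t)=0$, $\mathbb{E}(\varepsilon_t^2)=\sigma^2(t)$, $0<\sigma^2(t)\le M<\infty$. For $s<t$, $\xi(t,s)=\det(\mathbf{\Phi}_{t,s})$, where $\mathbf{\Phi}_{t,s}$ is the $(t-s)\times(t-s)$ matrix whose $(i,j)$ entry is $\phi_{i-j+1}(s+i)$ if $0\le i-j\le p-1$, $-1$ if $j=i+1$, and $0$ otherwise; $\xi(t,t)=1$, $\xi(t,s)=0$ for $t<s$. Also $\xi^{(m)}(t,s)=\sum_{r=1}^{p+1-m}\phi_{m-1+r}(s+r)\xi(t,s+r)$ for $1\le m\le p$, $\xi_q(t,r)=\xi(t,r)+\sum_{l=1}^{q}\xi(t,r+l)\theta_l(r+l)$, $\xi_{s,q}(t,r)=\sum_{l=s+1-r}^{q}\xi(t,r+l)\theta_l(r+l)$. $B$ is the backshift operator, $By_t=y_{t-1}$. The skew multiplication $\circ$ is the associative noncommutative product determined by $B^i\circ B^j=B^{i+j}$ and $B^i\circ f(t)=f(t-i)B^i$ for a function $f$ of time; for an operator $\sum_r a_r(t)B^r$ and a sequence $f(t)$ (e.g. $\varphi(t)$, $u_t$), the expression $\big(\sum_r a_r(t)B^r\big)\circ f(t)$ in the equation stands for $\sum_r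 a_r(t)f(t-r)$. With $s=t-k$: $$\Xi_{t,p}^{[k]}(B)=1-\sum_{m=1}^{p}\xi^{(m)}(t,s)B^{k-1+m},\qquad \Xi_t^{(k)}(B)=\sum_{r=0}^{k-1}\xi(t,t-r)B^r,$$ $$\Xi_{t,q}^{(k)}(B)=\sum_{r=0}^{k-1}\xi_q(t,t-r)B^r+\sum_{r=k}^{k-1+q}\xi_{s,q}(t,t-r)B^r .$$ *)

theory Defs
  imports "HOL-Probability.Probability" "Jordan_Normal_Form.Determinant"
begin

text \<open>
  Coefficients and processes are families of real random variables indexed by integer time,
  i.e. functions \<open>int \<Rightarrow> 'w \<Rightarrow> real\<close>; deterministic coefficients are the families that are
  constant in the outcome. \<open>\<phi> m t w\<close> is the coefficient of \<open>y\<^sub>t\<^sub>-\<^sub>m\<close> and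
  \<open>\<theta> l t w\<close> that of \<open>\<epsilon>\<^sub>t\<^sub>-\<^sub>l\<close>.
\<close>

text \<open>
  Both \<open>mat\<close> and \<open>det\<close> are those of the entry \<open>Jordan_Normal_Form\<close>, whose indices start at 0.
  The entry at \<open>(i, j)\<close> is thus the entry \<open>(i + 1, j + 1)\<close> in mathematical notation,
  which accounts for the shifted time argument.
\<close>

definition Phi_mat ::
  "nat \<Rightarrow> (nat \<Rightarrow> int \<Rightarrow> 'w \<Rightarrow> real) \<Rightarrow> int \<Rightarrow> int \<Rightarrow> 'w \<Rightarrow> real Matrix.mat" where
  "Phi_mat p \<phi> t s w =
     Matrix.mat (nat (t - s)) (nat (t - s))
       (\<lambda>(i, j). if j \<le> i \<and> i - j \<le> p - 1 then \<phi> (i - j + 1) (s + int i + 1) w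
                 else if j = i + 1 then - 1
                 else 0)"

definition xi ::
  "nat \<Rightarrow> (nat \<Rightarrow> int \<Rightarrow> 'w \<Rightarrow> real) \<Rightarrow> int \<Rightarrow> int \<Rightarrow> 'w \<Rightarrow> real" where
  "xi p \<phi> t s w =
     (if s < t then Determinant.det (Phi_mat p \<phi> t s w) else if s = t then 1 else 0)"

definition xi_upper ::
  "nat \<Rightarrow> (nat \<Rightarrow> int \<Rightarrow> 'w \<Rightarrow> real) \<Rightarrow> nat \<Rightarrow> int \<Rightarrow> int \<Rightarrow> 'w \<Rightarrow> real" where
  "xi_upper p \<phi> m t s w =
     (\<Sum>r = 1..p + 1 - m. \<phi> (m - 1 + r) (s + int r) w * xi p \<phi> t (s + int r) w)"

definition xi_q ::
  "nat \<Rightarrow> nat \<Rightarrow> (nat \<Rightarrow> int \<Rightarrow> 'w \<Rightarrow> real) \<Rightarrow> (nat \<Rightarrow> int \<Rightarrow> 'w \<Rightarrow> real) \<Rightarrow>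
     int \<Rightarrow> int \<Rightarrow> 'w \<Rightarrow> real" where
  "xi_q p q \<phi> \<theta> t r w =
     xi p \<phi> t r w + (\<Sum>l = 1..q. xi p \<phi> t (r + int l) w * \<theta> l (r + int l) w)"

text \<open>Only used for \<open>r \<le> s\<close>, where \<open>s + 1 - r \<ge> 1\<close> and \<open>nat\<close> does not truncate.\<close>

definition xi_sq ::
  "nat \<Rightarrow> nat \<Rightarrow> (nat \<Rightarrow> int \<Rightarrow> 'w \<Rightarrow> real) \<Rightarrow> (nat \<Rightarrow> int \<Rightarrow> 'w \<Rightarrow> real) \<Rightarrow>
     int \<Rightarrow> int \<Rightarrow> int \<Rightarrow> 'w \<Rightarrow> real" where
  "xi_sq p q \<phi> \<theta> s t r w =
     (\<Sum>l = nat (s + 1 - r)..q. xi p \<phi> t (r + int l) w * \<theta> l (r + int l) w)"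

definition ma_part ::
  "nat \<Rightarrow> (nat \<Rightarrow> int \<Rightarrow> 'w \<Rightarrow> real) \<Rightarrow> (int \<Rightarrow> 'w \<Rightarrow> real) \<Rightarrow> int \<Rightarrow> 'w \<Rightarrow> real" where
  "ma_part q \<theta> \<epsilon> t w = \<epsilon> t w + (\<Sum>l = 1..q. \<theta> l t w * \<epsilon> (t - int l) w)"

text \<open>Equations between random variables are understood almost surely.\<close>

definition tv_arma ::
  "'w measure \<Rightarrow> nat \<Rightarrow> nat \<Rightarrow> (int \<Rightarrow> 'w \<Rightarrow> real) \<Rightarrow> (nat \<Rightarrow> int \<Rightarrow> 'w \<Rightarrow> real) \<Rightarrow>
     (nat \<Rightarrow> int \<Rightarrow> 'w \<Rightarrow> real) \<Rightarrow> (int \<Rightarrow> 'w \<Rightarrow> real) \<Rightarrow> (int \<Rightarrow> 'w \<Rightarrow> real) \<Rightarrow> bool" where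
  "tv_arma M p q \<phi>0 \<phi> \<theta> \<epsilon> y \<longleftrightarrow>
     (\<forall>t. AE w in M. y t w =
        \<phi>0 t w + (\<Sum>m = 1..p. \<phi> m t w * y (t - int m) w) + ma_part q \<theta> \<epsilon> t w)"

text \<open>The \<open>\<sigma>\<close>-algebra generated by the variables \<open>y s\<close> with \<open>s < t\<close>.\<close>

definition past :: "'w measure \<Rightarrow> (int \<Rightarrow> 'w \<Rightarrow> real) \<Rightarrow> int \<Rightarrow> 'w measure" where
  "past M y t =
     sigma (space M) (\<Union>s\<in>{..<t}. {y s -` A \<inter> space M | A. A \<in> sets borel})"

text \<open>
  An operator \<open>\<Sum>\<^sub>r a\<^sub>r(t) B\<^sup>r\<close> is represented, at each time and outcome, by the polynomial in
  \<open>B\<close> with the coefficients \<open>a\<^sub>r(t)\<close> written on the left. The multiplication of the type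
  \<open>poly\<close> is commutative, hence not the skew multiplication of operators, and is never used here.
  Skew multiplication enters only through \<open>B\<^sup>r \<circ> f(t) = f(t - r) B\<^sup>r\<close>, which gives both
  \<open>A(B) f\<^sub>t\<close> and \<open>A(B) \<circ> f(t)\<close> the value \<open>\<Sum>\<^sub>r a\<^sub>r(t) f(t - r)\<close>.
\<close>

type_synonym 'w bop = "int \<Rightarrow> 'w \<Rightarrow> real poly"

definition bop_apply :: "'w bop \<Rightarrow> (int \<Rightarrow> 'w \<Rightarrow> real) \<Rightarrow> int \<Rightarrow> 'w \<Rightarrow> real" where
  "bop_apply A f t w = (\<Sum>r\<le>degree (A t w). coeff (A t w) r * f (t - int r) w)"

text \<open>For the operators below \<open>k \<ge> 1\<close> is intended, and \<open>s\<close> is \<open>t - k\<close>.\<close>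

definition Xi_p :: "nat \<Rightarrow> (nat \<Rightarrow> int \<Rightarrow> 'w \<Rightarrow> real) \<Rightarrow> nat \<Rightarrow> 'w bop" where
  "Xi_p p \<phi> k t w =
     1 - (\<Sum>m = 1..p. monom (xi_upper p \<phi> m t (t - int k) w) (k - 1 + m))"

definition Xi_k :: "nat \<Rightarrow> (nat \<Rightarrow> int \<Rightarrow> 'w \<Rightarrow> real) \<Rightarrow> nat \<Rightarrow> 'w bop" where
  "Xi_k p \<phi> k t w = (\<Sum>r = 0..k - 1. monom (xi p \<phi> t (t - int r) w) r)"

definition Xi_q ::
  "nat \<Rightarrow> nat \<Rightarrow> (nat \<Rightarrow> int \<Rightarrow> 'w \<Rightarrow> real) \<Rightarrow> (nat \<Rightarrow> int \<Rightarrow> 'w \<Rightarrow> real) \<Rightarrow>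
     nat \<Rightarrow> 'w bop" where
  "Xi_q p q \<phi> \<theta> k t w =
     (\<Sum>r = 0..k - 1. monom (xi_q p q \<phi> \<theta> t (t - int r) w) r) +
     (\<Sum>r = k..k - 1 + q. monom (xi_sq p q \<phi> \<theta> (t - int k) t (t - int r) w) r)"

text \<open>
  The two forms at a single outcome, for an arbitrary process \<open>z\<close>.
\<close>

definition explicit_form ::
  "nat \<Rightarrow> nat \<Rightarrow> (int \<Rightarrow> 'w \<Rightarrow> real) \<Rightarrow> (nat \<Rightarrow> int \<Rightarrow> 'w \<Rightarrow> real) \<Rightarrow>
     (nat \<Rightarrow> int \<Rightarrow> 'w \<Rightarrow> real) \<Rightarrow> (int \<Rightarrow> 'w \<Rightarrow> real) \<Rightarrow>
     int \<Rightarrow> int \<Rightarrow> (int \<Rightarrow> 'w \<Rightarrow> real) \<Rightarrow> 'w \<Rightarrow> bool" where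
  "explicit_form p q \<phi>0 \<phi> \<theta> \<epsilon> s t z w \<longleftrightarrow>
     z t w = (\<Sum>m = 1..p. xi_upper p \<phi> m t s w * z (s + 1 - int m) w)
           + (\<Sum>r = s + 1..t. xi p \<phi> t r w * \<phi>0 r w)
           + (\<Sum>r = s + 1..t. xi_q p q \<phi> \<theta> t r w * \<epsilon> r w)
           + (\<Sum>r = s + 1 - int q..s. xi_sq p q \<phi> \<theta> s t r w * \<epsilon> r w)"

definition operator_form ::
  "nat \<Rightarrow> nat \<Rightarrow> (int \<Rightarrow> 'w \<Rightarrow> real) \<Rightarrow> (nat \<Rightarrow> int \<Rightarrow> 'w \<Rightarrow> real) \<Rightarrow>
     (nat \<Rightarrow> int \<Rightarrow> 'w \<Rightarrow> real) \<Rightarrow> (int \<Rightarrow> 'w \<Rightarrow> real) \<Rightarrow>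
     nat \<Rightarrow> int \<Rightarrow> (int \<Rightarrow> 'w \<Rightarrow> real) \<Rightarrow> 'w \<Rightarrow> bool" where
  "operator_form p q \<phi>0 \<phi> \<theta> \<epsilon> k t z w \<longleftrightarrow>
     bop_apply (Xi_p p \<phi> k) z t w =
       bop_apply (Xi_k p \<phi> k) (\<lambda>t w. \<phi>0 t w + ma_part q \<theta> \<epsilon> t w) t w \<and>
     bop_apply (Xi_k p \<phi> k) (\<lambda>t w. \<phi>0 t w + ma_part q \<theta> \<epsilon> t w) t w =
       bop_apply (Xi_k p \<phi> k) \<phi>0 t w + bop_apply (Xi_q p q \<phi> \<theta> k) \<epsilon> t w"

end

theory Submission imports Defs begin

text \<open>
  Expanding \<open>\<Phi>\<^bsub>t,s\<^esub>\<close> along its first column gives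
  \<open>\<xi>(t,s) = \<Sum>\<^sub>m \<phi>\<^sub>m(s+m) \<xi>(t,s+m)\<close> for \<open>s < t\<close>, that is \<open>\<xi>(t,s) = \<xi>\<^sup>(\<^sup>1\<^sup>)(t,s)\<close>, while
  \<open>\<xi>\<^sup>(\<^sup>m\<^sup>)(t,s-1) = \<phi>\<^sub>m(s) \<xi>(t,s) + \<xi>\<^sup>(\<^sup>m\<^sup>+\<^sup>1\<^sup>)(t,s)\<close> by definition. Hence substituting the equation
  for \<open>y\<^sub>s\<close> into the representation with starting time \<open>s\<close> gives the one with starting time
  \<open>s - 1\<close>, and the coefficients in front of the forcing term \<open>\<phi>(r) + u\<^sub>r\<close> are \<open>\<xi>(t,r)\<close>. The moving
  average weights \<open>\<xi>\<^sub>q\<close> and \<open>\<xi>\<^bsub>s,q\<^esub>\<close> arise by collecting the terms of each \<open>\<epsilon>\<^sub>r\<close>. Everything holds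
  at each outcome at which all the (countably many) model equations hold.
\<close>

section \<open>The determinants and their recurrence\<close>

lemma Phi_mat_Suc_Suc:
  assumes "i < n" "j < n" "t = s + int (Suc n)"
  shows "Phi_mat p \<phi> t s w $$ (Suc i, Suc j) = Phi_mat p \<phi> t (s + 1) w $$ (i, j)"
  using assms by (simp add: Phi_mat_def algebra_simps)

text \<open>
  Deleting the first row and the second column of such a matrix leaves a matrix of the same shape,
  which is why the first column is arbitrary here.
\<close>

lemma det_Phi_mat_first_column:
  assumes "t = s + int (Suc n)"
  shows "Determinant.det (Matrix.mat (Suc n) (Suc n)
             (\<lambda>(i, j). if j = 0 then f i else Phi_mat p \<phi> t s w $$ (i, j)))
         = (\<Sum>i\<le>n. f i * xi p \<phi> t (s + int i + 1) w)"
  using assms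
proof (induction n arbitrary: s f)
  case 0
  then show ?case
    by (simp add: xi_def det_single)
next
  case (Suc n)
  define A where "A = Matrix.mat (Suc (Suc n)) (Suc (Suc n))
      (\<lambda>(i, j). if j = 0 then f i else Phi_mat p \<phi> t s w $$ (i, j))"
  \<comment> \<open>The first row is \<open>f 0\<close>, -1, 0, ..., so expansion along it, unlike
    expansion along the first column, leaves just two minors; the cofactor sign cancels the
    -1.\<close>
  have tail: "A $$ (0, Suc (Suc j)) = 0" if "j < n" for j
    using that Suc.prems by (simp add: A_def Phi_mat_def)
  have A00: "A $$ (0, 0) = f 0" and A01: "A $$ (0, Suc 0) = - 1"
    using Suc.prems by (simp_all add: A_def Phi_mat_def)
  have "mat_delete A 0 0 = Phi_mat p \<phi> t (s + 1) w"
    by (rule eq_matI)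
      (use Suc.prems in \<open>auto simp: A_def mat_delete_def Phi_mat_Suc_Suc Phi_mat_def algebra_simps\<close>)
  then have minor0: "Determinant.det (mat_delete A 0 0) = xi p \<phi> t (s + 1) w"
    using Suc.prems by (simp add: xi_def)
  have "mat_delete A 0 (Suc 0) = Matrix.mat (Suc n) (Suc n)
      (\<lambda>(i, j). if j = 0 then f (Suc i) else Phi_mat p \<phi> t (s + 1) w $$ (i, j))"
    by (rule eq_matI)
      (use Suc.prems in \<open>auto simp: A_def mat_delete_def Phi_mat_Suc_Suc\<close>)
  then have minor1: "Determinant.det (mat_delete A 0 (Suc 0))
      = (\<Sum>i\<le>n. f (Suc i) * xi p \<phi> t (s + 1 + int i + 1) w)"
    using Suc.IH[of "s + 1" "\<lambda>i. f (Suc i)"] Suc.prems by simp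
  have "Determinant.det A = (\<Sum>j<Suc (Suc n). A $$ (0, j) * cofactor A 0 j)"
    by (rule laplace_expansion_row) (simp_all add: A_def)
  also have "\<dots> = f 0 * xi p \<phi> t (s + 1) w + (\<Sum>i\<le>n. f (Suc i) * xi p \<phi> t (s + 1 + int i + 1) w)"
    unfolding sum.lessThan_Suc_shift
    by (simp add: tail A00 A01 cofactor_def minor0 minor1)
  also have "\<dots> = (\<Sum>i\<le>Suc n. f i * xi p \<phi> t (s + int i + 1) w)"
    unfolding sum.atMost_Suc_shift by (simp add: algebra_simps)
  finally show ?case
    by (simp add: A_def)
qed

lemma xi_eq_xi_upper_1:
  assumes "s < t" "1 \<le> p"
  shows "xi p \<phi> t s w = xi_upper p \<phi> 1 t s w"
proof -
  obtain n where t: "t = s + int (Suc n)"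
    using \<open>s < t\<close> by (metis zless_iff_Suc_zadd)
  define f where "f i = (if i \<le> p - 1 then \<phi> (i + 1) (s + int i + 1) w else 0)" for i
  define g where "g i = f i * xi p \<phi> t (s + int i + 1) w" for i
  have "Phi_mat p \<phi> t s w = Matrix.mat (Suc n) (Suc n)
      (\<lambda>(i, j). if j = 0 then f i else Phi_mat p \<phi> t s w $$ (i, j))"
    by (rule eq_matI) (auto simp: t f_def Phi_mat_def)
  then have "xi p \<phi> t s w = (\<Sum>i\<le>n. g i)"
    using det_Phi_mat_first_column[OF t, of f p \<phi> w] \<open>s < t\<close> by (simp add: xi_def g_def)
  \<comment> \<open>Both sums extend to a common bound: \<open>xi\<close> vanishes at times after
    \<open>t\<close>, that is for \<open>i\<close> above \<open>n\<close>, and \<open>f\<close>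
    vanishes for \<open>i\<close> above \<open>p - 1\<close>.\<close>
  also have "\<dots> = (\<Sum>i\<le>max n (p - 1). g i)"
    by (rule sum.mono_neutral_left) (auto simp: g_def xi_def t)
  also have "\<dots> = (\<Sum>i\<le>p - 1. g i)"
    by (rule sum.mono_neutral_right) (auto simp: g_def f_def)
  also have "\<dots> = (\<Sum>i<p. \<phi> (Suc i) (s + int (Suc i)) w * xi p \<phi> t (s + int (Suc i)) w)"
    by (rule sum.cong) (use \<open>1 \<le> p\<close> in \<open>auto simp: g_def f_def algebra_simps\<close>)
  also have "\<dots> = xi_upper p \<phi> 1 t s w"
    by (simp add: xi_upper_def sum.atLeast1_atMost_eq)
  finally show ?thesis .
qed

section \<open>Moving the starting time back\<close>

lemma sum_one_Suc_shift:
  fixes h :: "nat \<Rightarrow> 'a::comm_monoid_add"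
  shows "(\<Sum>r = 1..Suc n. h r) = h 1 + (\<Sum>r = 1..n. h (Suc r))"
  by (simp add: sum.atLeast_Suc_atMost sum.shift_bounds_cl_Suc_ivl del: sum.cl_ivl_Suc)

text \<open>The term \<open>r = 1\<close> is split off. At \<open>m = p\<close> the remaining
  \<open>xi_upper\<close> is an empty sum, hence 0.\<close>

lemma xi_upper_shift:
  assumes "m \<in> {1..p}"
  shows "xi_upper p \<phi> m t (s - 1) w = \<phi> m s w * xi p \<phi> t s w + xi_upper p \<phi> (Suc m) t s w"
proof -
  have "Suc (p - m) = p + 1 - m" using assms by auto
  then have "xi_upper p \<phi> m t (s - 1) w =
      (\<Sum>r = 1..Suc (p - m). \<phi> (m - 1 + r) (s - 1 + int r) w * xi p \<phi> t (s - 1 + int r) w)"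
    by (simp add: xi_upper_def)
  also have "\<dots> = \<phi> m s w * xi p \<phi> t s w +
      (\<Sum>r = 1..p - m. \<phi> (m - 1 + Suc r) (s - 1 + int (Suc r)) w * xi p \<phi> t (s - 1 + int (Suc r)) w)"
    unfolding sum_one_Suc_shift using assms by simp
  also have "(\<Sum>r = 1..p - m. \<phi> (m - 1 + Suc r) (s - 1 + int (Suc r)) w
      * xi p \<phi> t (s - 1 + int (Suc r)) w) = xi_upper p \<phi> (Suc m) t s w"
    unfolding xi_upper_def by (rule sum.cong) (use assms in auto)
  finally show ?thesis .
qed

text \<open>The forcing term is one arbitrary sequence \<open>v\<close>, so the moving average stays
  packed; induction on \<open>k\<close> eliminates \<open>y\<close> at the old starting
  time.\<close>

lemma xi_upper_representation:
  assumes eq: "\<And>\<tau>. y \<tau> w = v \<tau> + (\<Sum>m = 1..p. \<phi> m \<tau> w * y (\<tau> - int m) w)"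
    and "1 \<le> p" "1 \<le> k"
  shows "y t w = (\<Sum>m = 1..p. xi_upper p \<phi> m t (t - int k) w * y (t - int k + 1 - int m) w)
               + (\<Sum>r = 0..k - 1. xi p \<phi> t (t - int r) w * v (t - int r))"
  using \<open>1 \<le> k\<close>
proof (induction k rule: dec_induct)
  case base
  \<comment> \<open>From starting time \<open>t - 1\<close>, only \<open>xi\<close> at time
    \<open>t\<close>, which is 1, survives, so this case is the model equation itself.\<close>
  have "xi_upper p \<phi> m t (t - 1) w = \<phi> m t w" if "m \<in> {1..p}" for m
  proof -
    have "xi_upper p \<phi> (Suc m) t t w = 0"
      by (simp add: xi_upper_def xi_def)
    then show ?thesis
      using xi_upper_shift[OF that, of \<phi> t t w] by (simp add: xi_def)
  qed
  then show ?case
    using eq[of t] by (simp add: xi_def)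
next
  case (step k)
  define s where "s = t - int k"
  define X where "X m = xi_upper p \<phi> m t s w * y (s + 1 - int m) w" for m
  have "s < t" using step.hyps by (simp add: s_def)
  \<comment> \<open>This zero lets the index run to \<open>Suc p\<close>, so that splitting off
    \<open>X 1\<close> isolates \<open>y s\<close> and leaves the terms
    \<open>X (Suc m)\<close>.\<close>
  have Xp: "X (Suc p) = 0"
    by (simp add: X_def xi_upper_def)
  have "(\<Sum>m = 1..p. X m) = (\<Sum>m = 1..Suc p. X m)"
    by (simp add: Xp)
  also have "\<dots> = X 1 + (\<Sum>m = 1..p. X (Suc m))"
    by (rule sum_one_Suc_shift)
  also have "X 1 = xi p \<phi> t s w * y s w"
    by (simp add: X_def xi_eq_xi_upper_1[OF \<open>s < t\<close> \<open>1 \<le> p\<close>])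
  \<comment> \<open>The equation for \<open>y s\<close> is substituted; its lagged terms will merge
    with \<open>X (Suc m)\<close> through \<open>xi_upper_shift\<close>.\<close>
  also have "\<dots> = xi p \<phi> t s w * v s + (\<Sum>m = 1..p. \<phi> m s w * xi p \<phi> t s w * y (s - int m) w)"
    by (subst eq) (simp add: distrib_left sum_distrib_left mult_ac)
  finally have "(\<Sum>m = 1..p. X m) = xi p \<phi> t s w * v s
      + (\<Sum>m = 1..p. \<phi> m s w * xi p \<phi> t s w * y (s - int m) w + X (Suc m))"
    by (simp add: sum.distrib)
  also have "(\<Sum>m = 1..p. \<phi> m s w * xi p \<phi> t s w * y (s - int m) w + X (Suc m))
      = (\<Sum>m = 1..p. xi_upper p \<phi> m t (s - 1) w * y (s - int m) w)"
    by (rule sum.cong) (simp_all add: xi_upper_shift X_def algebra_simps)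
  finally have "(\<Sum>m = 1..p. X m) = xi p \<phi> t s w * v s
      + (\<Sum>m = 1..p. xi_upper p \<phi> m t (s - 1) w * y (s - int m) w)" .
  moreover have "(\<Sum>r = 0..Suc k - 1. xi p \<phi> t (t - int r) w * v (t - int r))
      = (\<Sum>r = 0..k - 1. xi p \<phi> t (t - int r) w * v (t - int r)) + xi p \<phi> t s w * v s"
    using step.hyps by (cases k) (simp_all add: s_def)
  moreover have Suc_k: "t - int (Suc k) = s - 1"
    by (simp add: s_def)
  ultimately show ?case
    using step.IH unfolding Suc_k by (simp add: X_def s_def)
qed

section \<open>Operators in B acting on sequences\<close>

lemma sum_backward_time:
  assumes "int k = t - s"
  shows "(\<Sum>r = s + 1..t. h r) = (\<Sum>r<k. h (t - int r))"
  by (rule sum.reindex_bij_witness[of _ "\<lambda>r. t - int r" "\<lambda>r. nat (t - r)"])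
    (use assms in auto)

text \<open>Cancellation or zero coefficients may lower the degree; a common bound \<open>N\<close>
  lets operators be compared termwise.\<close>

lemma bop_apply_eq_sum:
  assumes "degree (A t w) \<le> N"
  shows "bop_apply A f t w = (\<Sum>r\<le>N. coeff (A t w) r * f (t - int r) w)"
  unfolding bop_apply_def
  by (rule sum.mono_neutral_left) (use assms in \<open>auto simp: coeff_eq_0\<close>)

lemma bop_apply_add:
  "bop_apply (\<lambda>t w. A t w + B t w) f t w = bop_apply A f t w + bop_apply B f t w"
proof -
  define N where "N = max (degree (A t w)) (degree (B t w))"
  have "degree (A t w + B t w) \<le> N"
    by (simp add: N_def degree_add_le_max)
  then show ?thesis
    by (simp add: bop_apply_eq_sum[of _ _ _ N] N_def distrib_right sum.distrib)
qed

lemma bop_apply_diff: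
  "bop_apply (\<lambda>t w. A t w - B t w) f t w = bop_apply A f t w - bop_apply B f t w"
proof -
  define N where "N = max (degree (A t w)) (degree (B t w))"
  have "degree (A t w - B t w) \<le> N"
    by (simp add: N_def degree_diff_le_max)
  then show ?thesis
    by (simp add: bop_apply_eq_sum[of _ _ _ N] N_def left_diff_distrib sum_subtractf)
qed

lemma bop_apply_monom: "bop_apply (\<lambda>t w. monom (a t w) n) f t w = a t w * f (t - int n) w"
proof -
  have "bop_apply (\<lambda>t w. monom (a t w) n) f t w
      = (\<Sum>r\<le>n. if n = r then a t w * f (t - int n) w else 0)"
    unfolding bop_apply_eq_sum[of "\<lambda>t w. monom (a t w) n", OF degree_monom_le]
    by (rule sum.cong) auto
  then show ?thesis
    by simp
qed

lemma bop_apply_one: "bop_apply (\<lambda>t w. 1) f t w = f t w"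
  by (simp add: bop_apply_def)

lemma bop_apply_sum:
  assumes "finite I"
  shows "bop_apply (\<lambda>t w. \<Sum>i\<in>I. A i t w) f t w = (\<Sum>i\<in>I. bop_apply (A i) f t w)"
  using assms
  by (induction I rule: finite_induct) (simp_all add: bop_apply_add, simp add: bop_apply_def)

lemma bop_apply_Xi_p:
  assumes "1 \<le> k"
  shows "bop_apply (Xi_p p \<phi> k) z t w =
    z t w - (\<Sum>m = 1..p. xi_upper p \<phi> m t (t - int k) w * z (t - int k + 1 - int m) w)"
proof -
  \<comment> \<open>The subtraction \<open>k - 1\<close> is truncated, hence the appeal to
    \<open>1 \<le> k\<close>.\<close>
  have "t - int (k - 1 + m) = t - int k + 1 - int m" for m
    using assms by auto
  then show ?thesis
    unfolding Xi_p_def [abs_def]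
    by (simp only: bop_apply_diff bop_apply_one bop_apply_sum finite_atLeastAtMost bop_apply_monom)
qed

lemma bop_apply_Xi_k:
  "bop_apply (Xi_k p \<phi> k) v t w = (\<Sum>r = 0..k - 1. xi p \<phi> t (t - int r) w * v (t - int r) w)"
  unfolding Xi_k_def [abs_def]
  by (simp only: bop_apply_sum finite_atLeastAtMost bop_apply_monom)

lemma bop_apply_Xi_q:
  "bop_apply (Xi_q p q \<phi> \<theta> k) v t w =
     (\<Sum>r = 0..k - 1. xi_q p q \<phi> \<theta> t (t - int r) w * v (t - int r) w)
   + (\<Sum>r = k..k - 1 + q. xi_sq p q \<phi> \<theta> (t - int k) t (t - int r) w * v (t - int r) w)"
  unfolding Xi_q_def [abs_def]
  by (simp only: bop_apply_add bop_apply_sum finite_atLeastAtMost bop_apply_monom)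

section \<open>Collecting the moving average by noise time\<close>

text \<open>The term with \<open>\<theta> l\<close> at time \<open>r\<close> carries the noise at
  \<open>r - int l\<close>. Regrouping by noise time splits at \<open>s\<close>: later times give
  \<open>xi_q\<close>, the others \<open>xi_sq\<close>, where only lags reaching past
  \<open>s\<close> occur.\<close>

lemma xi_ma_part_sum:
  assumes "s \<le> t"
  shows "(\<Sum>r = s + 1..t. xi p \<phi> t r w * ma_part q \<theta> \<epsilon> r w) =
    (\<Sum>r = s + 1..t. xi_q p q \<phi> \<theta> t r w * \<epsilon> r w)
  + (\<Sum>r = s + 1 - int q..s. xi_sq p q \<phi> \<theta> s t r w * \<epsilon> r w)"
proof -
  define c where "c l r = xi p \<phi> t (r + int l) w * \<theta> l (r + int l) w * \<epsilon> r w" for l r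
  have c0: "c l r = 0" if "t < r + int l" for l r
    using that by (simp add: c_def xi_def)
  have "(\<Sum>r = s + 1..t. \<Sum>l = 1..q. xi p \<phi> t r w * \<theta> l r w * \<epsilon> (r - int l) w)
      = (\<Sum>l = 1..q. \<Sum>r = s + 1..t. c l (r - int l))"
    by (subst sum.swap) (simp add: c_def)
  also have "\<dots> = (\<Sum>l = 1..q. (\<Sum>r = s + 1..t. c l r) + (\<Sum>r = s + 1 - int l..s. c l r))"
  proof (rule sum.cong)
    fix l assume "l \<in> {1..q}"
    have "(\<Sum>r = s + 1..t. c l (r - int l)) = (\<Sum>r = s + 1 - int l..t - int l. c l r)"
      by (rule sum.reindex_bij_witness[of _ "\<lambda>r. r + int l" "\<lambda>r. r - int l"]) auto
    \<comment> \<open>The upper limit becomes independent of \<open>l\<close>, as \<open>xi\<close>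
      vanishes after \<open>t\<close>.\<close>
    also have "\<dots> = (\<Sum>r = s + 1 - int l..t. c l r)"
      by (rule sum.mono_neutral_left) (auto simp: c0)
    also have "{s + 1 - int l..t} = {s + 1..t} \<union> {s + 1 - int l..s}"
      using assms by auto
    also have "sum (c l) \<dots> = (\<Sum>r = s + 1..t. c l r) + (\<Sum>r = s + 1 - int l..s. c l r)"
      by (rule sum.union_disjoint) auto
    finally show "(\<Sum>r = s + 1..t. c l (r - int l))
        = (\<Sum>r = s + 1..t. c l r) + (\<Sum>r = s + 1 - int l..s. c l r)" .
  qed simp
  also have "\<dots> = (\<Sum>r = s + 1..t. \<Sum>l = 1..q. c l r)
      + (\<Sum>l = 1..q. \<Sum>r = s + 1 - int l..s. c l r)"
    unfolding sum.distrib by (rule arg_cong2[where f = "(+)"], rule sum.swap, rule refl)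
  \<comment> \<open>Both sides run over the same pairs: \<open>r \<le> s\<close> makes
    \<open>s + 1 - r\<close> at least 1, so the inner range contains only lags from 1 to
    \<open>q\<close>.\<close>
  also have "(\<Sum>l = 1..q. \<Sum>r = s + 1 - int l..s. c l r)
      = (\<Sum>r = s + 1 - int q..s. \<Sum>l = nat (s + 1 - r)..q. c l r)"
    by (subst (1 2) sum.Sigma, simp_all,
        rule sum.reindex_bij_witness[of _ "\<lambda>(r, l). (l, r)" "\<lambda>(l, r). (r, l)"]) auto
  finally show ?thesis
    by (simp add: ma_part_def xi_q_def xi_sq_def c_def distrib_left distrib_right
        sum.distrib sum_distrib_left sum_distrib_right mult.assoc)
qed

text \<open>This is \<open>xi_ma_part_sum\<close> with time \<open>r\<close> read as the power
  \<open>t - r\<close> of B; the second claim is the shape that matches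
  \<open>explicit_form\<close>.\<close>

lemma bop_apply_Xi_k_ma_part:
  assumes "1 \<le> k"
  shows "bop_apply (Xi_k p \<phi> k) (ma_part q \<theta> \<epsilon>) t w = bop_apply (Xi_q p q \<phi> \<theta> k) \<epsilon> t w"
    and "bop_apply (Xi_q p q \<phi> \<theta> k) \<epsilon> t w =
      (\<Sum>r = t - int k + 1..t. xi_q p q \<phi> \<theta> t r w * \<epsilon> r w)
    + (\<Sum>r = t - int k + 1 - int q..t - int k. xi_sq p q \<phi> \<theta> (t - int k) t r w * \<epsilon> r w)"
proof -
  \<comment> \<open>At \<open>k = 0\<close> the left side would be \<open>{0}\<close>, not
    empty.\<close>
  have k: "{0..k - Suc 0} = {..<k}"
    using assms by auto
  have tail: "(\<Sum>r = t - int k + 1 - int q..t - int k. h r) = (\<Sum>r = k..k - 1 + q. h (t - int r))"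
    for h :: "int \<Rightarrow> real"
    by (rule sum.reindex_bij_witness[of _ "\<lambda>r. t - int r" "\<lambda>r. nat (t - r)"])
      (use assms in auto)
  show eps: "bop_apply (Xi_q p q \<phi> \<theta> k) \<epsilon> t w =
      (\<Sum>r = t - int k + 1..t. xi_q p q \<phi> \<theta> t r w * \<epsilon> r w)
    + (\<Sum>r = t - int k + 1 - int q..t - int k. xi_sq p q \<phi> \<theta> (t - int k) t r w * \<epsilon> r w)"
    by (simp add: bop_apply_Xi_q k tail sum_backward_time[of k t "t - int k"])
  show "bop_apply (Xi_k p \<phi> k) (ma_part q \<theta> \<epsilon>) t w = bop_apply (Xi_q p q \<phi> \<theta> k) \<epsilon> t w"
    using xi_ma_part_sum[where s = "t - int k" and t = t and p = p and \<phi> = \<phi> and w = w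
        and q = q and \<theta> = \<theta> and \<epsilon> = \<epsilon>]
    by (simp add: eps bop_apply_Xi_k k sum_backward_time[of k t "t - int k"])
qed

section \<open>Equivalence and validity of the two forms\<close>

lemma bop_apply_add_right:
  "bop_apply A (\<lambda>t w. f t w + g t w) t w = bop_apply A f t w + bop_apply A g t w"
  by (simp add: bop_apply_def distrib_left sum.distrib)

text \<open>The second equation in \<open>operator_form\<close> is an identity, whatever
  \<open>z\<close> is. The first one is then the explicit form with the autoregressive sum moved to
  the left.\<close>

lemma explicit_form_iff_operator_form:
  assumes "s < t" "int k = t - s"
  shows "explicit_form p q \<phi>0 \<phi> \<theta> \<epsilon> s t z w \<longleftrightarrow> operator_form p q \<phi>0 \<phi> \<theta> \<epsilon> k t z w"
proof -
  have "1 \<le> k" and s: "s = t - int k"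
    using assms by auto
  have "{0..k - 1} = {..<k}"
    using \<open>1 \<le> k\<close> by auto
  then have "bop_apply (Xi_k p \<phi> k) \<phi>0 t w = (\<Sum>r = s + 1..t. xi p \<phi> t r w * \<phi>0 r w)"
    by (simp add: bop_apply_Xi_k sum_backward_time[OF assms(2)])
  then show ?thesis
    using bop_apply_Xi_k_ma_part[OF \<open>1 \<le> k\<close>, where p = p and \<phi> = \<phi> and q = q and \<theta> = \<theta> and \<epsilon> = \<epsilon>
        and t = t and w = w]
      bop_apply_Xi_p[OF \<open>1 \<le> k\<close>, where p = p and \<phi> = \<phi> and z = z and t = t and w = w]
    unfolding explicit_form_def operator_form_def bop_apply_add_right s
    by auto
qed

lemma operator_form_of_recurrence:
  assumes eq: "\<And>\<tau>. y \<tau> w =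
      \<phi>0 \<tau> w + (\<Sum>m = 1..p. \<phi> m \<tau> w * y (\<tau> - int m) w) + ma_part q \<theta> \<epsilon> \<tau> w"
    and "1 \<le> p" "1 \<le> k"
  shows "operator_form p q \<phi>0 \<phi> \<theta> \<epsilon> k t y w"
  unfolding operator_form_def
proof
  have eq': "y \<tau> w =
      (\<phi>0 \<tau> w + ma_part q \<theta> \<epsilon> \<tau> w) + (\<Sum>m = 1..p. \<phi> m \<tau> w * y (\<tau> - int m) w)" for \<tau>
    by (rule trans[OF eq]) simp
  show "bop_apply (Xi_p p \<phi> k) y t w =
      bop_apply (Xi_k p \<phi> k) (\<lambda>t w. \<phi>0 t w + ma_part q \<theta> \<epsilon> t w) t w"
    using xi_upper_representation[where y = y and w = w and p = p and \<phi> = \<phi>,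
        OF eq' \<open>1 \<le> p\<close> \<open>1 \<le> k\<close>, of t] \<open>1 \<le> k\<close>
    by (simp add: bop_apply_Xi_p bop_apply_Xi_k)
  show "bop_apply (Xi_k p \<phi> k) (\<lambda>t w. \<phi>0 t w + ma_part q \<theta> \<epsilon> t w) t w =
      bop_apply (Xi_k p \<phi> k) \<phi>0 t w + bop_apply (Xi_q p q \<phi> \<theta> k) \<epsilon> t w"
    using \<open>1 \<le> k\<close> by (simp add: bop_apply_add_right bop_apply_Xi_k_ma_part(1))
qed

theorem theorem10:
  fixes M :: "'w measure" and p q k :: nat and s t :: int
    and \<phi>0 :: "int \<Rightarrow> 'w \<Rightarrow> real" and \<phi> \<theta> :: "nat \<Rightarrow> int \<Rightarrow> 'w \<Rightarrow> real"
    and \<epsilon> y :: "int \<Rightarrow> 'w \<Rightarrow> real" and \<sigma>2 :: "int \<Rightarrow> real" and C :: real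
  assumes "prob_space M" and "1 \<le> p" and "1 \<le> q"
    and "\<And>\<tau>. \<phi>0 \<tau> \<in> borel_measurable M"
    and "\<And>m \<tau>. m \<in> {1..p} \<Longrightarrow> \<phi> m \<tau> \<in> borel_measurable M"
    and "\<And>l \<tau>. l \<in> {1..q} \<Longrightarrow> \<theta> l \<tau> \<in> borel_measurable M"
    and "\<And>\<tau>. y \<tau> \<in> borel_measurable M"
    and "\<And>\<tau>. \<epsilon> \<tau> \<in> borel_measurable M"
    and "\<And>\<tau>. integrable M (\<lambda>w. (\<epsilon> \<tau> w)\<^sup>2)"
    and "\<And>\<tau>. (\<integral>w. \<epsilon> \<tau> w \<partial>M) = 0"
    and "\<And>\<tau> \<tau>'. \<tau> \<noteq> \<tau>' \<Longrightarrow> (\<integral>w. \<epsilon> \<tau> w * \<epsilon> \<tau>' w \<partial>M) = 0"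
    and "\<And>\<tau>. AE w in M. real_cond_exp M (past M y \<tau>) (\<epsilon> \<tau>) w = 0"
    and "\<And>\<tau>. (\<integral>w. (\<epsilon> \<tau> w)\<^sup>2 \<partial>M) = \<sigma>2 \<tau>"
    and "\<And>\<tau>. 0 < \<sigma>2 \<tau> \<and> \<sigma>2 \<tau> \<le> C"
    and "tv_arma M p q \<phi>0 \<phi> \<theta> \<epsilon> y"
    and "s < t" and "int k = t - s"
  shows "(AE w in M. explicit_form p q \<phi>0 \<phi> \<theta> \<epsilon> s t y w)
       \<and> (AE w in M. operator_form p q \<phi>0 \<phi> \<theta> \<epsilon> k t y w)
       \<and> (\<forall>z. (AE w in M. explicit_form p q \<phi>0 \<phi> \<theta> \<epsilon> s t z w)
              \<longleftrightarrow> (AE w in M. operator_form p q \<phi>0 \<phi> \<theta> \<epsilon> k t z w))"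
proof -
  have k: "1 \<le> k"
    using \<open>s < t\<close> \<open>int k = t - s\<close> by simp
  \<comment> \<open>The exceptional null sets, one for each integer time, unite to a null
    set.\<close>
  have "AE w in M. \<forall>\<tau>. y \<tau> w =
      \<phi>0 \<tau> w + (\<Sum>m = 1..p. \<phi> m \<tau> w * y (\<tau> - int m) w) + ma_part q \<theta> \<epsilon> \<tau> w"
    using \<open>tv_arma M p q \<phi>0 \<phi> \<theta> \<epsilon> y\<close> by (simp add: tv_arma_def AE_all_countable)
  then have "AE w in M. operator_form p q \<phi>0 \<phi> \<theta> \<epsilon> k t y w"
  proof eventually_elim
    case (elim w)
    show ?case
      by (rule operator_form_of_recurrence[OF _ \<open>1 \<le> p\<close> k]) (rule elim[rule_format])
  qed
  \<comment> \<open>The equivalence is pointwise in the outcome, so it carries over to the almost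
    sure statements for every \<open>z\<close>.\<close>
  then show ?thesis
    by (simp add: explicit_form_iff_operator_form[OF \<open>s < t\<close> \<open>int k = t - s\<close>])
qed

end
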